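(* Let $T \in \mathbb{N} \cup \{+\infty\}$ and let $\mathbb{N}_{\le T} = \{0,1,\dots,T\}$ (with $\mathbb{N}_{\le T} = \mathbb{N}$ if $T = +\infty$) and $\mathbb{N}_{\le T-1}$ defined analogously. Consider random regressors $M_t \in \mathbb{R}^{m \times n}$, outputs $y_{t+1} \in \mathbb{R}^m$ and noise vectors $w_t \in \mathbb{R}^m$ satisfying $y_{t+1} = M_t \theta^\star + w_t$ for $t \in \mathbb{N}_{\le T-1}$, where $\theta^\star \in \mathbb{R}^n$ is a deterministic vector. Let $\mathcal{D}_t = \{M_0, y_1, M_1, \dots, y_t, M_t\}$, let $W \succ 0$ be a symmetric positive definite $m\times m$ matrix, and define $$V_t = \sum_{k=0}^{t-1} M_k^\top W M_k, \qquad s_t = \sum_{k=0}^{t-1} M_k^\top W w_k.$$ Assume that for a known constant $c_w > 0$ and all $t \in \mathbb{N}_{\le T-1}$, $$\forall \nu \in \mathbb{R}^m,\quad \mathbb{E}\left[e^{\nu^\top w_t} \mid \mathcal{D}_t\right] \le e^{\frac12 c_w^2 \nu^\top W^{-1} \nu}.$$ Let $z \in \mathbb{R}^n$, let $\bar P \in \mathbb{R}^{n\times n}$ be symmetric positive definite, and let $\delta \in (0,1)$. Then, with probability at least $1-\delta$, for all $t \in \mathbb{N}_{\le T}$ simultaneously, $$\|z + s_t\|^2_{(\bar P + V_t)^{-1}} \le \|z\|^2_{\bar P^{-1}} + c_w^2\left(\log\left|I_n + \bar P^{-1} V_t\right| + 2\log(1/\delta)\right).$$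
   Context: For a symmetric positive definite matrix $A$, $\|x\|_A^2 = x^\top A x$. $|A|$ denotes the determinant of a square matrix $A$. *)

theory Defs
  imports "HOL-Probability.Probability"
begin

definition pos_def_mat :: "real^'n^'n \<Rightarrow> bool" where
  "pos_def_mat A \<longleftrightarrow> transpose A = A \<and> (\<forall>x. x \<noteq> 0 \<longrightarrow> 0 < x \<bullet> (A *v x))"

definition wnorm2 :: "real^'n^'n \<Rightarrow> real^'n \<Rightarrow> real" where
  "wnorm2 A x = x \<bullet> (A *v x)"

definition Vmat :: "real^'m^'m \<Rightarrow> (nat \<Rightarrow> 'a \<Rightarrow> real^'n^'m) \<Rightarrow> nat \<Rightarrow> 'a \<Rightarrow> real^'n^'n" where
  "Vmat W Mx t \<omega> = (\<Sum>k<t. transpose (Mx k \<omega>) ** W ** Mx k \<omega>)"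

definition svec :: "real^'m^'m \<Rightarrow> (nat \<Rightarrow> 'a \<Rightarrow> real^'n^'m) \<Rightarrow> (nat \<Rightarrow> 'a \<Rightarrow> real^'m) \<Rightarrow> nat \<Rightarrow> 'a \<Rightarrow> real^'n" where
  "svec W Mx w t \<omega> = (\<Sum>k<t. transpose (Mx k \<omega>) *v (W *v w k \<omega>))"

definition data_sigma :: "'a measure \<Rightarrow> (nat \<Rightarrow> 'a \<Rightarrow> real^'n^'m) \<Rightarrow> (nat \<Rightarrow> 'a \<Rightarrow> real^'m) \<Rightarrow> nat \<Rightarrow> 'a measure" where
  "data_sigma M Mx y t = sigma (space M)
     ({Mx k -` A \<inter> space M | k A. k \<le> t \<and> A \<in> sets borel} \<union>
      {y k -` B \<inter> space M | k B. 1 \<le> k \<and> k \<le> t \<and> B \<in> sets borel})"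

end

theory Submission
  imports Defs
begin

text \<open>Method of mixtures. For every fixed $x$ the process
  $D_t(x) = \exp\bigl((x^\top (z + s_t) - \frac12 x^\top (\bar P + V_t) x) / c_w^2\bigr)$
  is a nonnegative supermartingale, by the sub-Gaussian bound in the random direction
  $\nu = W M_t x / c_w^2$. Integrating over $x$ with respect to Lebesgue measure keeps the
  supermartingale property, and the Gaussian integral evaluates the mixture to
  $K |\bar P + V_t|^{-1/2} \exp\bigl(\|z + s_t\|^2_{(\bar P + V_t)^{-1}} / (2 c_w^2)\bigr)$.
  Ville's maximal inequality at level $1/\delta$ times the (deterministic) initial value,
  followed by taking logarithms, gives the bound.\<close>

section \<open>Gaussian integrals\<close>

text \<open>The terms \<open>x \<bullet> z\<close> and \<open>x \<bullet> (Pbar *v x)\<close> in the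
  exponent are an unnormalised Gaussian prior with mean \<open>Pbar^{-1} z\<close> and covariance
  \<open>cw^2 Pbar^{-1}\<close>. Its mass is never computed separately: one integral formula serves
  at time \<open>t\<close> and at time 0, and the common constant cancels when the two are compared.
  Two obstacles shape the argument. The exceptional null set in the moment hypothesis may depend on
  the deterministic direction, while the direction actually needed is random, although known at time
  \<open>t\<close>. And conditional expectations are defined only up to null sets, so a
  supermartingale inequality for each \<open>x\<close> does not integrate over \<open>x\<close>
  directly. The property is therefore stated as an inequality between integrals over every event of
  the past; in this form it passes to the mixture by Tonelli and monotonicity, and it is all that
  the maximal inequality requires. A finite horizon is treated together with the infinite one by
  letting the mixture be 0 after \<open>T\<close>.\<close>

lemma nn_integral_lborel_shear:
  fixes f :: "'a::euclidean_space \<Rightarrow> ennreal"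
  assumes [measurable]: "f \<in> borel_measurable borel" "g \<in> borel_measurable borel"
    and b: "b \<in> Basis" and g: "\<And>x r. g (x + r *\<^sub>R b) = g x"
  shows "(\<integral>\<^sup>+x. f (x + g x *\<^sub>R b) \<partial>lborel) = (\<integral>\<^sup>+x. f x \<partial>lborel)"
proof -
  interpret product_sigma_finite "\<lambda>_::'a. lborel :: real measure"
    by standard
  define I where "I = Basis - {b}"
  have B: "Basis = insert b I" and I: "finite I" "b \<notin> I"
    using b by (auto simp: I_def)
  have split: "(\<integral>\<^sup>+x. h x \<partial>lborel) =
      (\<integral>\<^sup>+x. (\<integral>\<^sup>+y. h (y *\<^sub>R b + (\<Sum>j\<in>I. x j *\<^sub>R j)) \<partial>lborel) \<partial>Pi\<^sub>M I (\<lambda>_. lborel))"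
    if [measurable]: "h \<in> borel_measurable borel" for h :: "'a \<Rightarrow> ennreal"
  proof -
    have "(\<integral>\<^sup>+x. h x \<partial>lborel) = (\<integral>\<^sup>+x. h (\<Sum>j\<in>insert b I. x j *\<^sub>R j) \<partial>Pi\<^sub>M (insert b I) (\<lambda>_. lborel))"
      unfolding B[symmetric] by (subst lborel_eq) (simp add: nn_integral_distr)
    also have "\<dots> = (\<integral>\<^sup>+x. (\<integral>\<^sup>+y. h (\<Sum>j\<in>insert b I. (x(b := y)) j *\<^sub>R j) \<partial>lborel) \<partial>Pi\<^sub>M I (\<lambda>_. lborel))"
      by (rule product_nn_integral_insert) (use I in auto)
    finally have "(\<integral>\<^sup>+x. h x \<partial>lborel) =
      (\<integral>\<^sup>+x. (\<integral>\<^sup>+y. h (\<Sum>j\<in>insert b I. (x(b := y)) j *\<^sub>R j) \<partial>lborel) \<partial>Pi\<^sub>M I (\<lambda>_. lborel))" .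
    moreover have "(\<Sum>j\<in>insert b I. (x(b := y)) j *\<^sub>R j) = y *\<^sub>R b + (\<Sum>j\<in>I. x j *\<^sub>R j)" for x y
    proof -
      have "(\<Sum>j\<in>I. (x(b := y)) j *\<^sub>R j) = (\<Sum>j\<in>I. x j *\<^sub>R j)"
        using I by (intro sum.cong) auto
      then show "(\<Sum>j\<in>insert b I. (x(b := y)) j *\<^sub>R j) = y *\<^sub>R b + (\<Sum>j\<in>I. x j *\<^sub>R j)"
        using I by simp
    qed
    ultimately show ?thesis by simp
  qed
  \<comment> \<open>By \<open>split\<close> it suffices to look at one line parallel to
    \<open>b\<close>. There \<open>g\<close> has the constant value \<open>g v\<close>, so the shear
    is a translation of the real line.\<close>
  have "(\<integral>\<^sup>+y. f (y *\<^sub>R b + v + g (y *\<^sub>R b + v) *\<^sub>R b) \<partial>lborel) = (\<integral>\<^sup>+y. f (y *\<^sub>R b + v) \<partial>lborel)"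
    for v
  proof -
    have "(\<integral>\<^sup>+y. f (y *\<^sub>R b + v) \<partial>lborel) = (\<integral>\<^sup>+y. f ((g v + 1 * y) *\<^sub>R b + v) \<partial>lborel)"
      by (subst nn_integral_real_affine[where c=1 and t="g v"]) simp_all
    moreover have "g (y *\<^sub>R b + v) = g v" for y
      using g[of v y] by (simp add: add.commute)
    ultimately show ?thesis
      by (simp add: algebra_simps)
  qed
  then show ?thesis
    by (simp add: split)
qed

text \<open>Lebesgue measure is determined by its values on boxes, and swapping two coordinates
  sends a box to a box with the same side lengths in another order.
  \<open>Transposition.transpose\<close> is the swap of two indices, not the transpose of a
  matrix.\<close>

lemma nn_integral_lborel_transpose:
  fixes f :: "real^'n \<Rightarrow> ennreal"
  assumes [measurable]: "f \<in> borel_measurable borel"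
  shows "(\<integral>\<^sup>+x. f (\<chi> i. x $ Transposition.transpose m n i) \<partial>lborel) = (\<integral>\<^sup>+x. f x \<partial>lborel)"
proof -
  define S :: "real^'n \<Rightarrow> real^'n" where "S x = (\<chi> i. x $ Transposition.transpose m n i)" for x
  have "linear S"
    by (auto simp: S_def linear_iff vec_eq_iff)
  then have [measurable]: "S \<in> borel_measurable borel"
    by (intro borel_measurable_continuous_onI linear_continuous_on linear_conv_bounded_linear[THEN iffD1])
  have "lborel = distr lborel borel S"
  proof (rule lborel_eqI)
    fix l u :: "real^'n" assume lu: "\<And>b. b \<in> Basis \<Longrightarrow> l \<bullet> b \<le> u \<bullet> b"
    have mem: "x \<in> box l u \<longleftrightarrow> (\<forall>i. l $ i < x $ i \<and> x $ i < u $ i)" for x l u :: "real^'n"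
      by (auto simp: mem_box Basis_vec_def inner_axis)
    have eq: "S -` box l u = box (S l) (S u)"
    proof (intro set_eqI)
      fix x
      have "(\<forall>i. P (Transposition.transpose m n i)) \<longleftrightarrow> (\<forall>i. P i)" for P
        by (metis transpose_involutory)
      from this[of "\<lambda>i. l $ i < x $ Transposition.transpose m n i \<and> x $ Transposition.transpose m n i < u $ i"]
      show "x \<in> S -` box l u \<longleftrightarrow> x \<in> box (S l) (S u)"
        by (simp add: mem S_def)
    qed
    have Basis: "(\<Prod>b\<in>Basis. h b) = (\<Prod>i\<in>UNIV. h (axis i 1))" for h :: "real^'n \<Rightarrow> real"
      by (simp add: Basis_vec_def UNION_singleton_eq_range prod.reindex axis_eq_axis inj_on_def)
    have le: "l $ i \<le> u $ i" for i
      using lu[of "axis i 1"] by (simp add: inner_axis axis_in_Basis_iff)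
    have "emeasure (distr lborel borel S) (box l u) = emeasure lborel (box (S l) (S u))"
      by (simp add: emeasure_distr eq)
    also have "\<dots> = (\<Prod>b\<in>Basis. (S u - S l) \<bullet> b)"
      using le by (intro emeasure_lborel_box) (auto simp: Basis_vec_def inner_axis S_def)
    also have "(\<Prod>b\<in>Basis. (S u - S l) \<bullet> b) = (\<Prod>i\<in>UNIV. u $ Transposition.transpose m n i - l $ Transposition.transpose m n i)"
      by (simp add: Basis inner_axis S_def)
    also have "\<dots> = (\<Prod>i\<in>UNIV. u $ i - l $ i)"
      by (rule prod.reindex_bij_betw[where g="\<lambda>i. u $ i - l $ i"]) simp
    also have "\<dots> = (\<Prod>b\<in>Basis. (u - l) \<bullet> b)"
      by (simp add: Basis inner_axis)
    finally show "emeasure (distr lborel borel S) (box l u) = (\<Prod>b\<in>Basis. (u - l) \<bullet> b)" .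
  qed simp
  then have "(\<integral>\<^sup>+x. f x \<partial>lborel) = (\<integral>\<^sup>+x. f x \<partial>distr lborel borel S)"
    by simp
  also have "\<dots> = (\<integral>\<^sup>+x. f (S x) \<partial>lborel)"
    by (simp add: nn_integral_distr)
  finally show ?thesis
    by (simp add: S_def)
qed

lemma borel_measurable_matrix_vector_mult [measurable (raw)]:
  fixes A :: "'a \<Rightarrow> real^'n^'m" and x :: "'a \<Rightarrow> real^'n"
  assumes "A \<in> borel_measurable M" "x \<in> borel_measurable M"
  shows "(\<lambda>\<omega>. A \<omega> *v x \<omega>) \<in> borel_measurable M"
proof -
  have "continuous_on UNIV (\<lambda>p::(real^'n^'m) \<times> (real^'n). fst p *v snd p)"
    unfolding matrix_vector_mult_def by (intro continuous_intros)
  then show ?thesis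
    using borel_measurable_continuous_Pair[OF assms, where H="(*v)"] by simp
qed

text \<open>The library's linear change of variables needs a well-ordered index type; this version
  holds for every finite index type, since it uses elementary matrices only.\<close>

lemma nn_integral_lborel_linear:
  fixes A :: "real^'n^'n"
  assumes "det A \<noteq> 0" and "f \<in> borel_measurable borel"
  shows "(\<integral>\<^sup>+x. f x \<partial>lborel) = ennreal \<bar>det A\<bar> * (\<integral>\<^sup>+x. f (A *v x) \<partial>lborel)"
proof -
  \<comment> \<open>The quantifier over \<open>f\<close> belongs inside \<open>P\<close>: in the
    product case the hypothesis for \<open>B\<close> is applied to \<open>f\<close> composed with
    the map of \<open>A\<close>. Singular matrices satisfy \<open>P\<close> vacuously, which settles
    the case of a zero row.\<close>
  define P where "P A \<longleftrightarrow> (det A \<noteq> 0 \<longrightarrow> (\<forall>f\<in>borel_measurable borel.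
      (\<integral>\<^sup>+x. f x \<partial>lborel) = ennreal \<bar>det A\<bar> * (\<integral>\<^sup>+x. f (A *v x) \<partial>lborel)))"
    for A :: "real^'n^'n"
  have PD: "(\<integral>\<^sup>+x. f x \<partial>lborel) = ennreal \<bar>det A\<bar> * (\<integral>\<^sup>+x. f (A *v x) \<partial>lborel)"
    if "P A" "det A \<noteq> 0" "f \<in> borel_measurable borel" for A f
    using that unfolding P_def by blast
  have "P A"
  proof (induction A rule: induct_matrix_elementary)
    case (1 A B)
    show ?case
      unfolding P_def
    proof (intro impI ballI)
      fix f :: "real^'n \<Rightarrow> ennreal"
      assume "det (A ** B) \<noteq> 0" and [measurable]: "f \<in> borel_measurable borel"
      then have "det A \<noteq> 0" "det B \<noteq> 0"
        by (auto simp: det_mul)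
      then have A: "(\<integral>\<^sup>+x. f x \<partial>lborel) = ennreal \<bar>det A\<bar> * (\<integral>\<^sup>+x. f (A *v x) \<partial>lborel)"
        and B: "(\<integral>\<^sup>+x. f (A *v x) \<partial>lborel) = ennreal \<bar>det B\<bar> * (\<integral>\<^sup>+x. f (A *v (B *v x)) \<partial>lborel)"
        using PD[OF 1(1), of f] PD[OF 1(2), of "\<lambda>x. f (A *v x)"] by simp_all
      show "(\<integral>\<^sup>+x. f x \<partial>lborel) = ennreal \<bar>det (A ** B)\<bar> * (\<integral>\<^sup>+x. f (A ** B *v x) \<partial>lborel)"
        unfolding A B by (simp add: det_mul abs_mult ennreal_mult matrix_vector_mul_assoc mult.assoc)
    qed
  next
    case (2 A i)
    then have "det A = 0"
      by (intro det_zero_row(2))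
    then show ?case by (simp add: P_def)
  next
    case (3 A)
    have det: "det A = (\<Prod>i\<in>UNIV. A $ i $ i)"
      by (rule det_diagonal) (use 3 in auto)
    show ?case
      unfolding P_def
    proof (intro impI ballI)
      fix f :: "real^'n \<Rightarrow> ennreal"
      assume nz: "det A \<noteq> 0" and [measurable]: "f \<in> borel_measurable borel"
      define c where "c b = (A *v b) \<bullet> b" for b
      have c: "c (axis i 1) = A $ i $ i" for i
        by (simp add: c_def inner_axis matrix_vector_mul_component inner_axis)
      have c0: "c j \<noteq> 0" if "j \<in> Basis" for j
        using that nz by (auto simp: det Basis_vec_def c)
      have T: "A *v x = 0 + (\<Sum>j\<in>Basis. (c j * (x \<bullet> j)) *\<^sub>R j)" for x
      proof (rule euclidean_eqI)
        fix b :: "real^'n" assume b: "b \<in> Basis"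
        then obtain i where i: "b = axis i 1"
          by (auto simp: Basis_vec_def)
        have "(A *v x) $ i = (\<Sum>j\<in>UNIV. if j = i then A $ i $ i * x $ i else 0)"
          unfolding matrix_vector_mult_def vec_lambda_beta using 3 by (intro sum.cong) auto
        then have "(A *v x) \<bullet> b = c b * (x \<bullet> b)"
          by (simp add: i c inner_axis)
        then show "(A *v x) \<bullet> b = (0 + (\<Sum>j\<in>Basis. (c j * (x \<bullet> j)) *\<^sub>R j)) \<bullet> b"
          using b by (simp add: inner_sum_left_Basis)
      qed
      have "(\<Prod>j\<in>Basis. \<bar>c j\<bar>) = \<bar>det A\<bar>"
        by (simp add: Basis_vec_def UNION_singleton_eq_range prod.reindex axis_eq_axis inj_on_def det c abs_prod)
      then have "lborel = density (distr lborel borel ((*v) A)) (\<lambda>_. ennreal \<bar>det A\<bar>)"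
        using lborel_affine_euclidean[of c 0, OF c0] unfolding T[symmetric] by simp
      then have "(\<integral>\<^sup>+x. f x \<partial>lborel) = (\<integral>\<^sup>+x. f x \<partial>density (distr lborel borel ((*v) A)) (\<lambda>_. ennreal \<bar>det A\<bar>))"
        by simp
      also have "\<dots> = ennreal \<bar>det A\<bar> * (\<integral>\<^sup>+x. f (A *v x) \<partial>lborel)"
        by (simp add: nn_integral_density nn_integral_distr nn_integral_cmult)
      finally show "(\<integral>\<^sup>+x. f x \<partial>lborel) = ennreal \<bar>det A\<bar> * (\<integral>\<^sup>+x. f (A *v x) \<partial>lborel)" .
    qed
  next
    case (4 m n)
    let ?S = "(\<chi> i j. mat 1 $ i $ Transposition.transpose m n j) :: real^'n^'n"
    have "?S *v x = (\<chi> i. x $ Transposition.transpose m n i)" for x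
    proof (simp add: vec_eq_iff matrix_vector_mult_def mat_def, intro allI)
      fix i
      have "(if i = Transposition.transpose m n j then 1 else 0) * x $ j =
          (if j = Transposition.transpose m n i then x $ j else 0)" for j
        by (metis mult_1 mult_zero_left transpose_involutory)
      then show "(\<Sum>j\<in>UNIV. (if i = Transposition.transpose m n j then 1 else 0) * x $ j) = x $ Transposition.transpose m n i"
        by simp
    qed
    moreover have "\<bar>det ?S\<bar> = 1"
      using det_permute_columns[of "Transposition.transpose m n" "mat 1 :: real^'n^'n"]
      by (simp add: permutes_swap_id sign_def)
    ultimately show ?case
      by (simp add: P_def nn_integral_lborel_transpose)
  next
    case (5 m n c)
    let ?S = "(\<chi> i j. if i = m \<and> j = n then c else of_bool (i = j)) :: real^'n^'n"
    have "?S = (\<chi> k. if k = m then row m (mat 1) + c *s row n (mat 1) else row k (mat 1))"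
      using 5 by (auto simp: vec_eq_iff row_def mat_def)
    then have "det ?S = 1"
      using det_row_operation[OF 5, of "mat 1 :: real^'n^'n" c] by simp
    moreover have "?S *v x = x + (c * x $ n) *\<^sub>R axis m 1" for x
    proof (rule vec_eq_iff[THEN iffD2], rule allI)
      fix i
      have "?S $ i $ j * x $ j = (if j = i then x $ i else 0) + (if j = n then of_bool (i = m) * c * x $ n else 0)" for j
        using 5 by auto
      then have "(\<Sum>j\<in>UNIV. ?S $ i $ j * x $ j) = x $ i + of_bool (i = m) * c * x $ n"
        by (simp only: sum.distrib) simp
      then show "(?S *v x) $ i = (x + (c * x $ n) *\<^sub>R axis m 1) $ i"
        unfolding matrix_vector_mult_def by (simp add: axis_def)
    qed
    \<comment> \<open>As \<open>m\<close> and \<open>n\<close> differ, the shift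
      \<open>c * x $ n\<close> is constant along \<open>axis m 1\<close>, as the shear lemma
      demands.\<close>
    moreover have "(\<integral>\<^sup>+x. f (x + (c * x $ n) *\<^sub>R axis m 1) \<partial>lborel) = (\<integral>\<^sup>+x. f x \<partial>lborel)"
      if "f \<in> borel_measurable borel" for f :: "real^'n \<Rightarrow> ennreal"
      using that 5 by (intro nn_integral_lborel_shear) (auto simp: axis_in_Basis_iff, simp add: axis_def)
    ultimately show ?case
      by (simp add: P_def)
  qed
  then show ?thesis
    using assms by (rule PD)
qed

section \<open>Positive definite matrices and their congruence to the identity\<close>

lemma inner_matrix_vector_symmetric:
  fixes A :: "real^'n^'n"
  assumes "transpose A = A"
  shows "x \<bullet> (A *v y) = (A *v x) \<bullet> y"
  using dot_lmul_matrix[of x A y] assms by (metis vector_transpose_matrix)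

text \<open>Gram-Schmidt for the inner product \<open>x \<bullet> (A *v y)\<close>: the columns of
  \<open>C\<close> are an orthonormal basis for it, built by induction over finite sets of indices.
  \<open>C\<close> plays the part of an inverse square root of \<open>A\<close>, with no spectral
  theorem involved.\<close>

lemma pos_def_mat_congruent_one:
  fixes A :: "real^'n^'n"
  assumes "pos_def_mat A"
  obtains C :: "real^'n^'n" where "transpose C ** A ** C = mat 1"
proof -
  have sym: "x \<bullet> (A *v y) = (A *v x) \<bullet> y" for x y
    using assms by (intro inner_matrix_vector_symmetric) (simp add: pos_def_mat_def)
  have "\<exists>b. \<forall>i\<in>S. \<forall>j\<in>S. b i \<bullet> (A *v b j) = of_bool (i = j)" for S :: "'n set"
    using finite[of S]
  proof (induction S)
    case (insert k S)
    then obtain b where b: "\<And>i j. i \<in> S \<Longrightarrow> j \<in> S \<Longrightarrow> b i \<bullet> (A *v b j) = of_bool (i = j)"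
      by blast
    let ?Z = "(\<lambda>i. A *v b i) ` S"
    \<comment> \<open>As \<open>k\<close> lies outside \<open>S\<close>, the vectors
      \<open>A *v b i\<close> span a proper subspace. A nonzero \<open>v\<close> orthogonal to them
      in the Euclidean sense is orthogonal to every \<open>b i\<close> for the form of
      \<open>A\<close>; dividing by \<open>sqrt q\<close> normalises it.\<close>
    have "card S < CARD('n)"
      using insert.hyps by (intro psubset_card_mono) auto
    moreover have "dim ?Z \<le> card S"
      using card_image_le[of S "\<lambda>i. A *v b i"] dim_le_card'[of ?Z] by simp
    ultimately obtain v where "v \<noteq> 0" and v: "\<And>y. y \<in> span ?Z \<Longrightarrow> orthogonal v y"
      using orthogonal_to_subspace_exists[of ?Z] by (auto simp: DIM_cart)
    define q where "q = v \<bullet> (A *v v)"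
    have "0 < q"
      using assms \<open>v \<noteq> 0\<close> by (simp add: q_def pos_def_mat_def)
    define b' where "b' = b(k := (1 / sqrt q) *\<^sub>R v)"
    have kk: "b' k \<bullet> (A *v b' k) = 1"
      using \<open>0 < q\<close> by (simp add: b'_def matrix_vector_mult_scaleR q_def[symmetric])
    have ki: "b' k \<bullet> (A *v b' i) = 0" if "i \<in> S" for i
    proof -
      have "v \<bullet> (A *v b i) = 0"
        using v[of "A *v b i"] that by (auto simp: orthogonal_def span_base)
      then show ?thesis
        using that insert.hyps by (auto simp: b'_def)
    qed
    have ik: "b' i \<bullet> (A *v b' k) = 0" if "i \<in> S" for i
      using ki[OF that] sym[of "b' i" "b' k"] by (simp add: inner_commute)
    have "b' i = b i" if "i \<in> S" for i
      using that insert.hyps by (auto simp: b'_def)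
    then have "b' i \<bullet> (A *v b' j) = of_bool (i = j)" if "i \<in> insert k S" "j \<in> insert k S" for i j
      using that b kk ki ik insert.hyps by (cases "i = k"; cases "j = k") auto
    then show ?case by blast
  qed auto
  then obtain b :: "'n \<Rightarrow> real^'n" where b: "\<And>i j. b i \<bullet> (A *v b j) = of_bool (i = j)"
    by (meson UNIV_I)
  define C :: "real^'n^'n" where "C = (\<chi> i j. b j $ i)"
  have "(transpose C ** (A ** C)) $ i $ j = b i \<bullet> (A *v b j)" for i j
    by (simp add: matrix_matrix_mult_def transpose_def inner_vec_def matrix_vector_mult_def C_def)
  then have "transpose C ** A ** C = mat 1"
    by (simp add: b vec_eq_iff mat_def matrix_mul_assoc[symmetric])
  then show ?thesis by (rule that)
qed

lemma pos_def_mat_det_pos: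
  fixes A :: "real^'n^'n"
  assumes "pos_def_mat A"
  shows "0 < det A"
proof -
  obtain C :: "real^'n^'n" where "transpose C ** A ** C = mat 1"
    using pos_def_mat_congruent_one[OF assms] .
  then have "det (transpose C ** A ** C) = 1"
    by simp
  then have "(det C)\<^sup>2 * det A = 1"
    by (simp add: det_mul power2_eq_square mult.commute mult.left_commute)
  then show ?thesis
    by (smt (verit) mult_nonneg_nonpos zero_le_power2)
qed

lemma
  fixes A :: "real^'n^'n"
  assumes "det A \<noteq> 0"
  shows matrix_inv_right: "A ** matrix_inv A = mat 1"
    and matrix_inv_left: "matrix_inv A ** A = mat 1"
  using assms someI_ex[of "\<lambda>B. A ** B = mat 1 \<and> B ** A = mat 1"]
  unfolding invertible_det_nz[symmetric] invertible_def matrix_inv_def by blast+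

lemma nn_integral_gaussian_standard:
  fixes c :: real
  assumes "0 < c"
  shows "(\<integral>\<^sup>+x. ennreal (exp (- (x \<bullet> (x::'a::euclidean_space)) / (2 * c\<^sup>2))) \<partial>lborel)
    = ennreal (sqrt (2 * pi * c\<^sup>2) ^ DIM('a))"
proof -
  have 1: "(\<integral>\<^sup>+y. ennreal (exp (- y\<^sup>2 / (2 * c\<^sup>2))) \<partial>lborel) = ennreal (sqrt (2 * pi * c\<^sup>2))"
  proof -
    have "(\<integral>\<^sup>+y. ennreal (exp (- y\<^sup>2 / (2 * c\<^sup>2))) \<partial>lborel)
        = (\<integral>\<^sup>+y. ennreal (sqrt (2 * pi * c\<^sup>2)) * ennreal (normal_density 0 c y) \<partial>lborel)"
      using assms by (intro nn_integral_cong) (simp add: normal_density_def ennreal_mult[symmetric])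
    also have "\<dots> = ennreal (sqrt (2 * pi * c\<^sup>2)) * (\<integral>\<^sup>+y. ennreal (normal_density 0 c y) \<partial>lborel)"
      by (simp add: nn_integral_cmult)
    also have "(\<integral>\<^sup>+y. ennreal (normal_density 0 c y) \<partial>lborel) = 1"
      using assms by (subst nn_integral_eq_integral) (auto simp: integral_normal_density)
    finally show ?thesis by simp
  qed
  have "exp (- (x \<bullet> x) / (2 * c\<^sup>2)) = (\<Prod>b\<in>Basis. exp (- (x \<bullet> b)\<^sup>2 / (2 * c\<^sup>2)))" for x :: 'a
    by (subst euclidean_inner) (simp add: power2_eq_square exp_sum[symmetric] sum_negf sum_divide_distrib)
  then have "(\<integral>\<^sup>+x. ennreal (exp (- (x \<bullet> (x::'a)) / (2 * c\<^sup>2))) \<partial>lborel)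
      = (\<integral>\<^sup>+x. (\<Prod>b\<in>Basis. ennreal (exp (- ((x::'a) \<bullet> b)\<^sup>2 / (2 * c\<^sup>2)))) \<partial>lborel)"
    by (simp add: prod_ennreal)
  also have "\<dots> = (\<Prod>b\<in>(Basis::'a set). (\<integral>\<^sup>+y. ennreal (exp (- y\<^sup>2 / (2 * c\<^sup>2))) \<partial>lborel))"
    by (rule nn_integral_lborel_prod) auto
  also have "\<dots> = ennreal (sqrt (2 * pi * c\<^sup>2) ^ DIM('a))"
    unfolding 1 by (simp add: ennreal_power)
  finally show ?thesis .
qed

text \<open>Complete the square and substitute \<open>x = b + C *v \<xi>\<close>, where
  \<open>C\<close> turns the form of \<open>A\<close> into \<open>\<xi> \<bullet> \<xi>\<close>. The
  Jacobian \<open>\<bar>det C\<bar>\<close> is \<open>1 / sqrt (det A)\<close>, by taking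
  determinants in the congruence.\<close>

lemma nn_integral_gaussian:
  fixes A :: "real^'n^'n" and u :: "real^'n" and c :: real
  assumes A: "pos_def_mat A" and c: "0 < c"
  shows "(\<integral>\<^sup>+x. ennreal (exp ((x \<bullet> u - x \<bullet> (A *v x) / 2) / c\<^sup>2)) \<partial>lborel)
    = ennreal (sqrt (2 * pi * c\<^sup>2) ^ CARD('n) / sqrt (det A)
        * exp (u \<bullet> (matrix_inv A *v u) / (2 * c\<^sup>2)))"
proof -
  obtain C :: "real^'n^'n" where C: "transpose C ** A ** C = mat 1"
    using pos_def_mat_congruent_one[OF A] .
  have dA: "0 < det A"
    by (rule pos_def_mat_det_pos[OF A])
  have "det (transpose C ** A ** C) = 1"
    by (simp add: C)
  then have "(det C)\<^sup>2 * det A = 1"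
    by (simp add: det_mul power2_eq_square mult.commute mult.left_commute)
  then have "(det C)\<^sup>2 = 1 / det A"
    using dA by (simp add: field_simps)
  then have dC: "\<bar>det C\<bar> = 1 / sqrt (det A)"
    unfolding real_sqrt_abs[symmetric] by (simp add: real_sqrt_divide)
  then have dC0: "det C \<noteq> 0"
    using dA by auto
  \<comment> \<open>The maximiser of the exponent: \<open>A *v b = u\<close> cancels the terms
    linear in \<open>\<xi>\<close> and leaves the constant \<open>u \<bullet> b / 2\<close>.\<close>
  define b where "b = matrix_inv A *v u"
  have Ab: "A *v b = u"
    using matrix_inv_right[of A] dA by (simp add: b_def matrix_vector_mul_assoc)
  have sym: "x \<bullet> (A *v y) = (A *v x) \<bullet> y" for x y
    using A by (intro inner_matrix_vector_symmetric) (simp add: pos_def_mat_def)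
  define f where "f x = ennreal (exp ((x \<bullet> u - x \<bullet> (A *v x) / 2) / c\<^sup>2))" for x
  have [measurable]: "f \<in> borel_measurable borel"
    unfolding f_def by measurable
  have f: "f (b + C *v \<xi>) = ennreal (exp (u \<bullet> b / (2 * c\<^sup>2))) * ennreal (exp (- (\<xi> \<bullet> \<xi>) / (2 * c\<^sup>2)))" for \<xi>
  proof -
    have "\<xi> \<bullet> \<xi> = \<xi> \<bullet> (transpose C ** A ** C *v \<xi>)"
      by (simp add: C)
    also have "\<dots> = \<xi> \<bullet> (transpose C *v (A *v (C *v \<xi>)))"
      by (simp only: matrix_vector_mul_assoc matrix_mul_assoc)
    also have "\<dots> = (C *v \<xi>) \<bullet> (A *v (C *v \<xi>))"
      using dot_lmul_matrix[of \<xi> "transpose C"] by simp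
    finally have *: "(C *v \<xi>) \<bullet> (A *v (C *v \<xi>)) = \<xi> \<bullet> \<xi>" ..
    have "b \<bullet> (A *v (C *v \<xi>)) = u \<bullet> (C *v \<xi>)"
      by (simp add: sym Ab)
    then have "(b + C *v \<xi>) \<bullet> u - (b + C *v \<xi>) \<bullet> (A *v (b + C *v \<xi>)) / 2 = u \<bullet> b / 2 + - (\<xi> \<bullet> \<xi>) / 2"
      using * by (simp add: matrix_vector_right_distrib inner_add_left inner_add_right Ab inner_commute[of _ u] field_simps)
    then have "((b + C *v \<xi>) \<bullet> u - (b + C *v \<xi>) \<bullet> (A *v (b + C *v \<xi>)) / 2) / c\<^sup>2
        = u \<bullet> b / (2 * c\<^sup>2) + - (\<xi> \<bullet> \<xi>) / (2 * c\<^sup>2)"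
      by (simp add: add_divide_distrib diff_divide_distrib)
    then show ?thesis
      unfolding f_def by (simp only: exp_add ennreal_mult[symmetric] exp_ge_zero)
  qed
  have "(\<integral>\<^sup>+x. f x \<partial>lborel) = (\<integral>\<^sup>+x. f x \<partial>distr lborel borel ((+) b))"
    by (simp add: lborel_distr_plus)
  also have "\<dots> = (\<integral>\<^sup>+x. f (b + x) \<partial>lborel)"
    by (simp add: nn_integral_distr)
  also have "\<dots> = ennreal \<bar>det C\<bar> * (\<integral>\<^sup>+\<xi>. f (b + C *v \<xi>) \<partial>lborel)"
    by (rule nn_integral_lborel_linear[OF dC0]) measurable
  also have "\<dots> = ennreal \<bar>det C\<bar> * (ennreal (exp (u \<bullet> b / (2 * c\<^sup>2))) * ennreal (sqrt (2 * pi * c\<^sup>2) ^ CARD('n)))"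
    unfolding f using nn_integral_gaussian_standard[OF c, where 'a="real^'n"]
    by (subst nn_integral_cmult) (simp_all add: DIM_cart)
  also have "\<dots> = ennreal (\<bar>det C\<bar> * (exp (u \<bullet> b / (2 * c\<^sup>2)) * sqrt (2 * pi * c\<^sup>2) ^ CARD('n)))"
    by (simp add: ennreal_mult)
  finally show ?thesis
    by (simp add: dC f_def b_def ac_simps)
qed

section \<open>Conditionally sub-Gaussian noise and maximal inequalities\<close>

text \<open>On each of the finitely many level sets of \<open>\<nu>\<close>, which lie in
  \<open>F\<close>, the direction is deterministic and the hypothesis applies. The weight
  \<open>g\<close> will carry the current value of the process together with the indicator of a past
  event.\<close>

lemma (in sigma_finite_subalgebra) nn_integral_exp_inner_le_simple:
  fixes w \<nu> :: "'a \<Rightarrow> 'b::euclidean_space" and q :: "'b \<Rightarrow> real" and g :: "'a \<Rightarrow> real"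
  assumes [measurable]: "w \<in> borel_measurable M"
    and cond: "\<And>v. AE \<omega> in M. nn_cond_exp M F (\<lambda>\<omega>. ennreal (exp (v \<bullet> w \<omega>))) \<omega> \<le> ennreal (exp (q v))"
    and \<nu>: "simple_function F \<nu>"
    and gF[measurable]: "g \<in> borel_measurable F" and g0: "\<And>\<omega>. 0 \<le> g \<omega>"
  shows "(\<integral>\<^sup>+\<omega>. ennreal (g \<omega> * exp (\<nu> \<omega> \<bullet> w \<omega> - q (\<nu> \<omega>))) \<partial>M) \<le> (\<integral>\<^sup>+\<omega>. ennreal (g \<omega>) \<partial>M)"
proof -
  have spF: "space F = space M" and FM: "\<And>f. f \<in> borel_measurable F \<Longrightarrow> f \<in> borel_measurable M"
    using subalg measurable_from_subalg[OF subalg] by (auto simp: subalgebra_def)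
  let ?R = "\<nu> ` space M"
  have fin: "finite ?R"
    using simple_functionD(1)[OF \<nu>] by (simp add: spF)
  define I where "I v = \<nu> -` {v} \<inter> space F" for v
  have I[measurable]: "I v \<in> sets F" for v
    unfolding I_def by (rule simple_functionD(2)[OF \<nu>])
  have IM[measurable]: "I v \<in> sets M" for v
    using I subalg by (auto simp: subalgebra_def)
  have gM[measurable]: "g \<in> borel_measurable M"
    by (rule FM[OF gF])
  have part: "(\<Sum>v\<in>?R. h v * indicator (I v) \<omega>) = h (\<nu> \<omega>)"
    if "\<omega> \<in> space M" for h :: "'b \<Rightarrow> ennreal" and \<omega>
  proof -
    have "(\<Sum>v\<in>?R. h v * indicator (I v) \<omega>) = (\<Sum>v\<in>?R. if v = \<nu> \<omega> then h v else 0)"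
      using that by (intro sum.cong) (auto simp: I_def spF)
    then show ?thesis using that fin by simp
  qed
  let ?h = "\<lambda>v \<omega>. ennreal (g \<omega> * exp (- q v)) * indicator (I v) \<omega>"
  have "(\<integral>\<^sup>+\<omega>. ennreal (g \<omega> * exp (\<nu> \<omega> \<bullet> w \<omega> - q (\<nu> \<omega>))) \<partial>M)
      = (\<integral>\<^sup>+\<omega>. (\<Sum>v\<in>?R. ennreal (g \<omega> * exp (v \<bullet> w \<omega> - q v)) * indicator (I v) \<omega>) \<partial>M)"
    by (intro nn_integral_cong) (simp add: part)
  also have "\<dots> = (\<Sum>v\<in>?R. \<integral>\<^sup>+\<omega>. ennreal (g \<omega> * exp (v \<bullet> w \<omega> - q v)) * indicator (I v) \<omega> \<partial>M)"
    by (rule nn_integral_sum) measurable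
  \<comment> \<open>\<open>?h v\<close> collects every factor measurable with respect to
    \<open>F\<close>, so that \<open>exp (v \<bullet> w \<omega>)\<close> alone is replaced by its
    conditional expectation.\<close>
  also have "\<dots> = (\<Sum>v\<in>?R. \<integral>\<^sup>+\<omega>. ?h v \<omega> * ennreal (exp (v \<bullet> w \<omega>)) \<partial>M)"
    using g0 by (intro sum.cong nn_integral_cong refl)
      (simp add: ennreal_mult[symmetric] indicator_def exp_diff exp_minus field_simps)
  also have "\<dots> \<le> (\<Sum>v\<in>?R. \<integral>\<^sup>+\<omega>. ennreal (g \<omega>) * indicator (I v) \<omega> \<partial>M)"
  proof (rule sum_mono)
    fix v
    have "(\<integral>\<^sup>+\<omega>. ?h v \<omega> * ennreal (exp (v \<bullet> w \<omega>)) \<partial>M)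
        = (\<integral>\<^sup>+\<omega>. ?h v \<omega> * nn_cond_exp M F (\<lambda>\<omega>. ennreal (exp (v \<bullet> w \<omega>))) \<omega> \<partial>M)"
      by (rule nn_cond_exp_intg[symmetric]) measurable
    also have "\<dots> \<le> (\<integral>\<^sup>+\<omega>. ?h v \<omega> * ennreal (exp (q v)) \<partial>M)"
      by (rule nn_integral_mono_AE) (use cond[of v] in eventually_elim, rule mult_left_mono, auto)
    also have "\<dots> = (\<integral>\<^sup>+\<omega>. ennreal (g \<omega>) * indicator (I v) \<omega> \<partial>M)"
      using g0 by (intro nn_integral_cong) (simp add: indicator_def ennreal_mult[symmetric] exp_minus)
    finally show "(\<integral>\<^sup>+\<omega>. ?h v \<omega> * ennreal (exp (v \<bullet> w \<omega>)) \<partial>M) \<le> \<dots>" .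
  qed
  also have "\<dots> = (\<integral>\<^sup>+\<omega>. (\<Sum>v\<in>?R. ennreal (g \<omega>) * indicator (I v) \<omega>) \<partial>M)"
    by (rule nn_integral_sum[symmetric]) measurable
  also have "\<dots> = (\<integral>\<^sup>+\<omega>. ennreal (g \<omega>) \<partial>M)"
    by (intro nn_integral_cong) (simp add: part)
  finally show ?thesis .
qed

text \<open>The moment bound is assumed for deterministic directions only; a random direction is
  approximated by simple functions, with Fatou's lemma for the limit.\<close>

lemma (in sigma_finite_subalgebra) nn_integral_exp_inner_le:
  fixes w \<nu> :: "'a \<Rightarrow> 'b::euclidean_space" and q :: "'b \<Rightarrow> real" and g :: "'a \<Rightarrow> real"
  assumes w[measurable]: "w \<in> borel_measurable M"
    and cond: "\<And>v. AE \<omega> in M. nn_cond_exp M F (\<lambda>\<omega>. ennreal (exp (v \<bullet> w \<omega>))) \<omega> \<le> ennreal (exp (q v))"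
    and q: "continuous_on UNIV q"
    and \<nu>: "\<nu> \<in> borel_measurable F"
    and g: "g \<in> borel_measurable F" "\<And>\<omega>. 0 \<le> g \<omega>"
  shows "(\<integral>\<^sup>+\<omega>. ennreal (g \<omega> * exp (\<nu> \<omega> \<bullet> w \<omega> - q (\<nu> \<omega>))) \<partial>M) \<le> (\<integral>\<^sup>+\<omega>. ennreal (g \<omega>) \<partial>M)"
proof -
  have spF: "space F = space M" and FM: "\<And>f::'a \<Rightarrow> 'b. f \<in> borel_measurable F \<Longrightarrow> f \<in> borel_measurable M"
    using subalg measurable_from_subalg[OF subalg] by (auto simp: subalgebra_def)
  have [measurable]: "g \<in> borel_measurable M"
    by (rule measurable_from_subalg[OF subalg g(1)])
  have [measurable]: "q \<in> borel_measurable borel"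
    by (rule borel_measurable_continuous_onI[OF q])
  obtain S where S: "\<And>i. simple_function F (S i)"
    and lim: "\<And>\<omega>. \<omega> \<in> space M \<Longrightarrow> (\<lambda>i. S i \<omega>) \<longlonglongrightarrow> \<nu> \<omega>"
    using borel_measurable_implies_sequence_metric[OF \<nu>] unfolding spF by metis
  have [measurable]: "S i \<in> borel_measurable M" for i
    by (rule FM[OF borel_measurable_simple_function[OF S]])
  let ?u = "\<lambda>i \<omega>. ennreal (g \<omega> * exp (S i \<omega> \<bullet> w \<omega> - q (S i \<omega>)))"
  have "(\<integral>\<^sup>+\<omega>. ennreal (g \<omega> * exp (\<nu> \<omega> \<bullet> w \<omega> - q (\<nu> \<omega>))) \<partial>M) = (\<integral>\<^sup>+\<omega>. liminf (\<lambda>i. ?u i \<omega>) \<partial>M)"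
  proof (rule nn_integral_cong)
    fix \<omega> assume "\<omega> \<in> space M"
    note lim[OF this]
    moreover from this have "(\<lambda>i. q (S i \<omega>)) \<longlonglongrightarrow> q (\<nu> \<omega>)"
      by (intro continuous_on_tendsto_compose[OF q]) auto
    ultimately have "(\<lambda>i. ?u i \<omega>) \<longlonglongrightarrow> ennreal (g \<omega> * exp (\<nu> \<omega> \<bullet> w \<omega> - q (\<nu> \<omega>)))"
      by (intro tendsto_ennrealI tendsto_intros)
    then show "ennreal (g \<omega> * exp (\<nu> \<omega> \<bullet> w \<omega> - q (\<nu> \<omega>))) = liminf (\<lambda>i. ?u i \<omega>)"
      by (intro lim_imp_Liminf[symmetric]) auto
  qed
  also have "\<dots> \<le> liminf (\<lambda>i. \<integral>\<^sup>+\<omega>. ?u i \<omega> \<partial>M)"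
    by (rule nn_integral_liminf) measurable
  also have "\<dots> \<le> liminf (\<lambda>i::nat. \<integral>\<^sup>+\<omega>. ennreal (g \<omega>) \<partial>M)"
    by (rule Liminf_mono) (intro always_eventually allI nn_integral_exp_inner_le_simple[OF w cond S g])
  also have "\<dots> = (\<integral>\<^sup>+\<omega>. ennreal (g \<omega>) \<partial>M)"
    by (rule Liminf_const) simp
  finally show ?thesis .
qed

text \<open>Optional stopping at the first passage above \<open>a\<close>, carried out by hand as an
  induction on time. The bound at each finite time does not depend on the time, so continuity from
  below gives it for the whole path.\<close>

lemma ville_maximal_inequality:
  fixes N :: "nat \<Rightarrow> 'a \<Rightarrow> ennreal" and F :: "nat \<Rightarrow> 'a measure"
  assumes sub: "\<And>t. subalgebra M (F t)"
    and mono: "\<And>s t. s \<le> t \<Longrightarrow> sets (F s) \<subseteq> sets (F t)"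
    and N: "\<And>t. N t \<in> borel_measurable (F t)"
    and super: "\<And>t A. A \<in> sets (F t) \<Longrightarrow> (\<integral>\<^sup>+\<omega>\<in>A. N (Suc t) \<omega> \<partial>M) \<le> (\<integral>\<^sup>+\<omega>\<in>A. N t \<omega> \<partial>M)"
  shows "a * emeasure M {\<omega> \<in> space M. \<exists>t. a < N t \<omega>} \<le> (\<integral>\<^sup>+\<omega>. N 0 \<omega> \<partial>M)"
proof -
  have sp: "space (F t) = space M" for t
    using sub[of t] by (simp add: subalgebra_def)
  have NF: "N s \<in> borel_measurable (F t)" if "s \<le> t" for s t
    using N[of s] mono[OF that] by (auto simp: measurable_def sp)
  have NM[measurable]: "N t \<in> borel_measurable M" for t
    using measurable_from_subalg[OF sub N] .
  \<comment> \<open>The strict bound \<open>s < n\<close> matters: \<open>B (Suc n)\<close> involves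
    times up to \<open>n\<close> only, hence is an event of \<open>F n\<close>, on which the step
    from \<open>n\<close> to \<open>Suc n\<close> may be taken.\<close>
  define B where "B n = {\<omega> \<in> space M. \<forall>s<n. N s \<omega> \<le> a}" for n
  have [measurable]: "B n \<in> sets M" for n
    unfolding B_def by measurable
  have BF: "B (Suc n) \<in> sets (F n)" for n
  proof -
    have "{\<omega> \<in> space (F n). \<forall>s<Suc n. N s \<omega> \<le> a} = (\<Inter>s\<in>{..n}. {\<omega> \<in> space (F n). N s \<omega> \<le> a})"
      by (auto simp: less_Suc_eq_le)
    also have "\<dots> \<in> sets (F n)"
    proof (intro sets.finite_INT)
      fix s assume "s \<in> {..n}"
      then have [measurable]: "N s \<in> borel_measurable (F n)"
        by (intro NF) simp
      show "{\<omega> \<in> space (F n). N s \<omega> \<le> a} \<in> sets (F n)"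
        by measurable
    qed auto
    finally show ?thesis
      unfolding B_def sp[of n] .
  qed
  \<comment> \<open>The left side is the expectation of the stopped process, with its value after a
    passage lowered to \<open>a\<close>.\<close>
  have main: "(\<integral>\<^sup>+\<omega>\<in>B n. N n \<omega> \<partial>M) + a * emeasure M (space M - B n) \<le> (\<integral>\<^sup>+\<omega>. N 0 \<omega> \<partial>M)" for n
  proof (induction n)
    case 0
    have "B 0 = space M"
      by (simp add: B_def)
    moreover have "(\<integral>\<^sup>+\<omega>\<in>space M. N 0 \<omega> \<partial>M) = (\<integral>\<^sup>+\<omega>. N 0 \<omega> \<partial>M)"
      by (rule nn_integral_cong) simp
    ultimately show ?case
      by simp
  next
    case (Suc n)
    \<comment> \<open>The paths whose first passage occurs exactly at time \<open>n\<close>; they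
      move from the integral term to the term with factor \<open>a\<close>.\<close>
    define C where "C = {\<omega> \<in> B n. a < N n \<omega>}"
    have [measurable]: "C \<in> sets M"
      unfolding C_def by measurable
    have Bn: "B n = B (Suc n) \<union> C" "B (Suc n) \<inter> C = {}"
      by (auto simp: B_def C_def less_Suc_eq)
    have "space M - B (Suc n) = (space M - B n) \<union> C" "(space M - B n) \<inter> C = {}"
      by (auto simp: B_def C_def less_Suc_eq)
    then have em: "emeasure M (space M - B (Suc n)) = emeasure M (space M - B n) + emeasure M C"
      by (simp add: plus_emeasure)
    have "a * emeasure M C = (\<integral>\<^sup>+\<omega>\<in>C. a \<partial>M)"
      by (simp add: nn_integral_cmult_indicator)
    also have "\<dots> \<le> (\<integral>\<^sup>+\<omega>\<in>C. N n \<omega> \<partial>M)"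
      by (intro nn_integral_mono) (auto simp: C_def indicator_def)
    finally have C: "a * emeasure M C \<le> (\<integral>\<^sup>+\<omega>\<in>C. N n \<omega> \<partial>M)" .
    have "(\<integral>\<^sup>+\<omega>\<in>B (Suc n). N (Suc n) \<omega> \<partial>M) + a * emeasure M (space M - B (Suc n))
        \<le> (\<integral>\<^sup>+\<omega>\<in>B (Suc n). N n \<omega> \<partial>M) + (\<integral>\<^sup>+\<omega>\<in>C. N n \<omega> \<partial>M) + a * emeasure M (space M - B n)"
      using add_mono[OF super[OF BF[of n]] C] by (simp add: em distrib_left ac_simps add_left_mono)
    also have "(\<integral>\<^sup>+\<omega>\<in>B (Suc n). N n \<omega> \<partial>M) + (\<integral>\<^sup>+\<omega>\<in>C. N n \<omega> \<partial>M) = (\<integral>\<^sup>+\<omega>\<in>B n. N n \<omega> \<partial>M)"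
      using Bn(2) unfolding Bn(1)
      by (subst nn_integral_add[symmetric]) (auto intro!: nn_integral_cong simp: indicator_def)
    finally show ?case
      using Suc.IH by (rule order_trans)
  qed
  have "{\<omega> \<in> space M. \<exists>t. a < N t \<omega>} = (\<Union>n. space M - B n)"
    by (auto simp: B_def not_le) (meson lessI not_le)
  moreover have "incseq (\<lambda>n. space M - B n)"
    by (auto simp: incseq_def B_def)
  ultimately have "emeasure M {\<omega> \<in> space M. \<exists>t. a < N t \<omega>} = (SUP n. emeasure M (space M - B n))"
    by (subst SUP_emeasure_incseq) auto
  then have "a * emeasure M {\<omega> \<in> space M. \<exists>t. a < N t \<omega>} = (SUP n. a * emeasure M (space M - B n))"
    by (simp add: SUP_mult_left_ennreal)
  also have "\<dots> \<le> (\<integral>\<^sup>+\<omega>. N 0 \<omega> \<partial>M)"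
  proof (rule SUP_least)
    fix n
    have "a * emeasure M (space M - B n) \<le> (\<integral>\<^sup>+\<omega>\<in>B n. N n \<omega> \<partial>M) + a * emeasure M (space M - B n)"
      by (rule add_increasing) simp_all
    then show "a * emeasure M (space M - B n) \<le> (\<integral>\<^sup>+\<omega>. N 0 \<omega> \<partial>M)"
      using main[of n] by (rule order_trans)
  qed
  finally show ?thesis .
qed

section \<open>The filtration generated by the data\<close>

lemma data_sigma_generator_subset_Pow:
  "{Mx k -` A \<inter> space M | k A. k \<le> t \<and> A \<in> sets borel} \<union>
      {y k -` B \<inter> space M | k B. 1 \<le> k \<and> k \<le> t \<and> B \<in> sets borel} \<subseteq> Pow (space M)"
  by auto

lemma space_data_sigma [simp]: "space (data_sigma M Mx y t) = space M"
  unfolding data_sigma_def by (rule space_measure_of[OF data_sigma_generator_subset_Pow])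

lemma sets_data_sigma:
  "sets (data_sigma M Mx y t) = sigma_sets (space M)
     ({Mx k -` A \<inter> space M | k A. k \<le> t \<and> A \<in> sets borel} \<union>
      {y k -` B \<inter> space M | k B. 1 \<le> k \<and> k \<le> t \<and> B \<in> sets borel})"
  unfolding data_sigma_def by (rule sets_measure_of[OF data_sigma_generator_subset_Pow])

lemma measurable_data_sigma:
  shows "k \<le> t \<Longrightarrow> Mx k \<in> borel_measurable (data_sigma M Mx y t)"
    and "1 \<le> k \<Longrightarrow> k \<le> t \<Longrightarrow> y k \<in> borel_measurable (data_sigma M Mx y t)"
  by (auto simp: measurable_def sets_data_sigma intro!: sigma_sets.Basic)

lemma sets_data_sigma_mono:
  "s \<le> t \<Longrightarrow> sets (data_sigma M Mx y s) \<subseteq> sets (data_sigma M Mx y t)"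
  unfolding sets_data_sigma by (rule sigma_sets_mono') (blast intro: le_trans)

lemma subalgebra_data_sigma:
  assumes "\<And>k. k \<le> t \<Longrightarrow> Mx k \<in> borel_measurable M"
    and "\<And>k. 1 \<le> k \<Longrightarrow> k \<le> t \<Longrightarrow> y k \<in> borel_measurable M"
  shows "subalgebra M (data_sigma M Mx y t)"
  unfolding subalgebra_def sets_data_sigma space_data_sigma
  using assms by (intro conjI refl sets.sigma_sets_subset) (auto intro: measurable_sets)

section \<open>The self-normalized bound\<close>

text \<open>Together with \<open>inner_svec\<close>, this splits the exponent of the process into
  one contribution per time step.\<close>

lemma Vmat_quadratic_form:
  "x \<bullet> (Vmat W Mx t \<omega> *v x) = (\<Sum>k<t. (Mx k \<omega> *v x) \<bullet> (W *v (Mx k \<omega> *v x)))"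
proof (induction t)
  case (Suc t)
  let ?B = "Mx t \<omega>"
  have "x \<bullet> ((transpose ?B ** W ** ?B) *v x) = x \<bullet> (transpose ?B *v (W *v (?B *v x)))"
    by (simp only: matrix_vector_mul_assoc matrix_mul_assoc)
  also have "\<dots> = (?B *v x) \<bullet> (W *v (?B *v x))"
    using dot_lmul_matrix[of x "transpose ?B"] by simp
  finally show ?case
    using Suc by (simp add: Vmat_def matrix_vector_mult_add_rdistrib inner_add_right)
qed (simp add: Vmat_def)

lemma inner_svec:
  "x \<bullet> svec W Mx w t \<omega> = (\<Sum>k<t. (Mx k \<omega> *v x) \<bullet> (W *v w k \<omega>))"
proof (induction t)
  case (Suc t)
  have "x \<bullet> (transpose (Mx t \<omega>) *v (W *v w t \<omega>)) = (Mx t \<omega> *v x) \<bullet> (W *v w t \<omega>)"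
    using dot_lmul_matrix[of x "transpose (Mx t \<omega>)"] by simp
  then show ?case
    using Suc by (simp add: svec_def inner_add_right)
qed (simp add: svec_def)

lemma transpose_Vmat:
  assumes "transpose W = W"
  shows "transpose (Vmat W Mx t \<omega>) = Vmat W Mx t \<omega>"
proof (induction t)
  case (Suc t)
  have "transpose (A + B) = transpose A + transpose B" for A B :: "real^'b^'b"
    by (simp add: transpose_def vec_eq_iff)
  then show ?case
    using Suc assms by (simp add: Vmat_def matrix_transpose_mul matrix_mul_assoc)
qed (simp add: Vmat_def transpose_def vec_eq_iff)

lemma pos_def_mat_add_Vmat:
  assumes P: "pos_def_mat P" and W: "pos_def_mat W"
  shows "pos_def_mat (P + Vmat W Mx t \<omega>)"
proof -
  have W0: "0 \<le> v \<bullet> (W *v v)" for v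
    using W by (cases "v = 0") (auto simp: pos_def_mat_def less_imp_le)
  have "transpose (P + Vmat W Mx t \<omega>) = transpose P + transpose (Vmat W Mx t \<omega>)"
    by (simp add: transpose_def vec_eq_iff)
  also have "\<dots> = P + Vmat W Mx t \<omega>"
    using P W by (simp add: transpose_Vmat pos_def_mat_def)
  finally have T: "transpose (P + Vmat W Mx t \<omega>) = P + Vmat W Mx t \<omega>" .
  have "0 < x \<bullet> ((P + Vmat W Mx t \<omega>) *v x)" if "x \<noteq> 0" for x
  proof -
    have "0 < x \<bullet> (P *v x)"
      using P that by (simp add: pos_def_mat_def)
    moreover have "0 \<le> x \<bullet> (Vmat W Mx t \<omega> *v x)"
      unfolding Vmat_quadratic_form by (intro sum_nonneg W0)
    ultimately show ?thesis
      by (simp add: matrix_vector_mult_add_rdistrib inner_add_right)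
  qed
  with T show ?thesis
    by (simp add: pos_def_mat_def)
qed

text \<open>Multiply by \<open>P\<close> on the left. This converts the quotient of determinants
  produced by the two Gaussian integrals into the determinant in the bound.\<close>

lemma det_one_add_inv_mult:
  fixes P V :: "real^'n^'n"
  assumes "det P \<noteq> 0"
  shows "det (mat 1 + matrix_inv P ** V) = det (P + V) / det P"
proof -
  have "P ** (mat 1 + matrix_inv P ** V) = P + V"
    using matrix_inv_right[OF assms] by (simp add: matrix_add_ldistrib matrix_mul_assoc)
  then have "det P * det (mat 1 + matrix_inv P ** V) = det (P + V)"
    by (metis det_mul)
  then show ?thesis
    using assms by (simp add: field_simps)
qed

text \<open>Take logarithms, cancel \<open>ln K\<close> and multiply by
  \<open>2 * c\<^sup>2\<close>. The square roots turn into halves, so the log-determinant ends with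
  factor 1 and \<open>ln (1 / \<delta>)\<close> with factor 2.\<close>

lemma gaussian_ratio_le_iff:
  fixes c \<delta> K p q :: real
  assumes "0 < K" "0 < p" "0 < q" "0 < c" "0 < \<delta>"
  shows "K / sqrt q * exp (b / (2 * c\<^sup>2)) \<le> K / sqrt p * exp (a / (2 * c\<^sup>2)) / \<delta>
    \<longleftrightarrow> b \<le> a + c\<^sup>2 * (ln (q / p) + 2 * ln (1 / \<delta>))"
proof -
  have "K / sqrt q * exp (b / (2 * c\<^sup>2)) \<le> K / sqrt p * exp (a / (2 * c\<^sup>2)) / \<delta>
    \<longleftrightarrow> ln (K / sqrt q * exp (b / (2 * c\<^sup>2))) \<le> ln (K / sqrt p * exp (a / (2 * c\<^sup>2)) / \<delta>)"
    using assms by (intro ln_le_cancel_iff[symmetric]) auto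
  also have "ln (K / sqrt q * exp (b / (2 * c\<^sup>2))) = ln K - ln q / 2 + b / (2 * c\<^sup>2)"
    using assms by (simp add: ln_mult ln_div ln_sqrt)
  also have "ln (K / sqrt p * exp (a / (2 * c\<^sup>2)) / \<delta>) = ln K - ln p / 2 + a / (2 * c\<^sup>2) - ln \<delta>"
    using assms by (simp add: ln_mult ln_div ln_sqrt)
  also have "ln K - ln q / 2 + b / (2 * c\<^sup>2) \<le> ln K - ln p / 2 + a / (2 * c\<^sup>2) - ln \<delta>
    \<longleftrightarrow> b / (2 * c\<^sup>2) \<le> a / (2 * c\<^sup>2) + (ln (q / p) + 2 * ln (1 / \<delta>)) / 2"
  proof -
    have "ln (q / p) + 2 * ln (1 / \<delta>) = ln q - ln p - 2 * ln \<delta>"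
      using assms by (simp add: ln_div)
    moreover have "k - lq / 2 + x \<le> k - lp / 2 + y - d \<longleftrightarrow> x \<le> y + (lq - lp - 2 * d) / 2"
      for k lq x lp y d :: real
      by (auto simp: field_simps)
    ultimately show ?thesis
      by simp
  qed
  also have "\<dots> \<longleftrightarrow> b \<le> a + c\<^sup>2 * (ln (q / p) + 2 * ln (1 / \<delta>))"
    using assms by (simp add: field_simps)
  finally show ?thesis .
qed

theorem theorem1:
  fixes M :: "'a measure" and T :: enat
    and Mx :: "nat \<Rightarrow> 'a \<Rightarrow> real^'n^'m"
    and y w :: "nat \<Rightarrow> 'a \<Rightarrow> real^'m"
    and \<theta> :: "real^'n" and W :: "real^'m^'m" and cw :: real
    and z :: "real^'n" and Pbar :: "real^'n^'n" and \<delta> :: real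
  assumes "prob_space M"
    and "\<And>t. enat t < T \<Longrightarrow> Mx t \<in> borel_measurable M"
    and "\<And>t. enat t < T \<Longrightarrow> w t \<in> borel_measurable M"
    and "\<And>t \<omega>. enat t < T \<Longrightarrow> \<omega> \<in> space M \<Longrightarrow> y (Suc t) \<omega> = Mx t \<omega> *v \<theta> + w t \<omega>"
    and "pos_def_mat W"
    and "cw > 0"
    and "\<And>t \<nu>. enat t < T \<Longrightarrow>
          AE \<omega> in M. nn_cond_exp M (data_sigma M Mx y t) (\<lambda>\<omega>. ennreal (exp (\<nu> \<bullet> w t \<omega>))) \<omega>
                 \<le> ennreal (exp (1/2 * cw^2 * (\<nu> \<bullet> (matrix_inv W *v \<nu>))))"
    and "pos_def_mat Pbar"
    and "0 < \<delta>" and "\<delta> < 1"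
  shows "measure M {\<omega> \<in> space M. \<forall>t. enat t \<le> T \<longrightarrow>
            wnorm2 (matrix_inv (Pbar + Vmat W Mx t \<omega>)) (z + svec W Mx w t \<omega>)
              \<le> wnorm2 (matrix_inv Pbar) z
                 + cw^2 * (ln (det (mat 1 + matrix_inv Pbar ** Vmat W Mx t \<omega>)) + 2 * ln (1/\<delta>))}
         \<ge> 1 - \<delta>"
proof -
  interpret prob_space M by fact
  have symW: "x \<bullet> (W *v v) = (W *v x) \<bullet> v" for x v
    using assms(5) by (intro inner_matrix_vector_symmetric) (simp add: pos_def_mat_def)
  have dW: "det W \<noteq> 0" and dP: "0 < det Pbar"
    using pos_def_mat_det_pos assms(5,8) by (metis less_irrefl, blast)
  have le: "enat k < T" if "k \<le> t" "enat t < T" for k t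
    using that by (meson enat_ord_simps(1) le_less_trans)

  \<comment> \<open>At \<open>t = T\<close> the data would include \<open>Mx T\<close>, whose
    measurability is assumed only before \<open>T\<close>. The full sigma-algebra can replace the
    data there, as no step of the process starts at \<open>T\<close> or later.\<close>
  define F where "F t = (if enat t < T then data_sigma M Mx y t else M)" for t
  have ymeas: "y k \<in> borel_measurable M" if k: "1 \<le> k" and "k \<le> t" "enat t < T" for k t
  proof -
    obtain j where j: "k = Suc j"
      using k by (cases k) auto
    have jT: "enat j < T"
      using le[of j t] that j by simp
    note [measurable] = assms(2)[OF jT] assms(3)[OF jT]
    have "(\<lambda>\<omega>. Mx j \<omega> *v \<theta> + w j \<omega>) \<in> borel_measurable M"
      by measurable
    then show ?thesis
      unfolding j using assms(4)[OF jT] by (simp cong: measurable_cong)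
  qed
  have sub: "subalgebra M (F t)" for t
  proof (cases "enat t < T")
    case True
    then show ?thesis
      unfolding F_def using assms(2) le ymeas by (auto intro!: subalgebra_data_sigma)
  qed (simp add: F_def subalgebra_def)
  have mono: "sets (F s) \<subseteq> sets (F t)" if "s \<le> t" for s t
  proof (cases "enat t < T")
    case True
    then show ?thesis
      using le[OF that True] sets_data_sigma_mono[OF that] by (simp add: F_def)
  next
    case False
    then show ?thesis
      using sub[of s] by (simp add: F_def subalgebra_def)
  qed
  have MF: "Mx k \<in> borel_measurable (F t)" if "k \<le> t" "enat k < T" for k t
    using that assms(2) by (simp add: F_def measurable_data_sigma)
  \<comment> \<open>The noise is not among the generators of the data; it is recovered as
    \<open>y (Suc k) - Mx k *v \<theta>\<close>, which is known only from time \<open>Suc k\<close>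
    on. Hence \<open>k < t\<close>, where \<open>MF\<close> has \<open>k \<le> t\<close>.\<close>
  have wF: "w k \<in> borel_measurable (F t)" if "k < t" "enat k < T" for k t
  proof (cases "enat t < T")
    case True
    have [measurable]: "Mx k \<in> borel_measurable (F t)" "y (Suc k) \<in> borel_measurable (F t)"
      using that True by (auto simp: F_def measurable_data_sigma)
    have "(\<lambda>\<omega>. y (Suc k) \<omega> - Mx k \<omega> *v \<theta>) \<in> borel_measurable (F t)"
      by measurable
    moreover have "w k \<omega> = y (Suc k) \<omega> - Mx k \<omega> *v \<theta>" if "\<omega> \<in> space (F t)" for \<omega>
      using that assms(4)[OF \<open>enat k < T\<close>] sub[of t] by (simp add: subalgebra_def)
    ultimately show ?thesis
      by (simp cong: measurable_cong)
  qed (use that assms(3) in \<open>simp add: F_def\<close>)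

  \<comment> \<open>Written with a sum over time steps, so that passing to \<open>Suc t\<close>
    multiplies by a single exponential factor; \<open>Neq\<close> returns to \<open>Vmat\<close> and
    \<open>svec\<close>.\<close>
  define D where "D t x \<omega> = exp ((x \<bullet> z - x \<bullet> (Pbar *v x) / 2
      + (\<Sum>k<t. (Mx k \<omega> *v x) \<bullet> (W *v w k \<omega>) - (Mx k \<omega> *v x) \<bullet> (W *v (Mx k \<omega> *v x)) / 2)) / cw\<^sup>2)"
    for t x \<omega>
  \<comment> \<open>The value 0 after \<open>T\<close> keeps the process a nonnegative
    supermartingale and never exceeds a threshold, so a bound for all natural times is a bound up to
    \<open>T\<close>.\<close>
  define N where "N t \<omega> = (if enat t \<le> T then \<integral>\<^sup>+x. ennreal (D t x \<omega>) \<partial>lborel else 0)" for t \<omega>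
  \<comment> \<open>Joint measurability in the sample point and \<open>x\<close>: it makes the
    mixture measurable at time \<open>t\<close> and is what Tonelli needs.\<close>
  have DF: "(\<lambda>p. D t (snd p) (fst p)) \<in> borel_measurable (F s \<Otimes>\<^sub>M lborel)"
    if "t \<le> s" "enat t \<le> T" for s t
  proof -
    have [measurable]: "(\<lambda>p. (Mx k (fst p) *v snd p) \<bullet> (W *v w k (fst p))
        - (Mx k (fst p) *v snd p) \<bullet> (W *v (Mx k (fst p) *v snd p)) / 2) \<in> borel_measurable (F s \<Otimes>\<^sub>M lborel)"
      if "k \<in> {..<t}" for k
    proof -
      have "enat k < T"
        using that \<open>enat t \<le> T\<close> by (metis enat_ord_simps(2) lessThan_iff less_le_trans)
      then have [measurable]: "Mx k \<in> borel_measurable (F s)" "w k \<in> borel_measurable (F s)"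
        using that \<open>t \<le> s\<close> by (auto intro!: MF wF)
      show ?thesis by measurable
    qed
    show ?thesis
      unfolding D_def by measurable
  qed
  have NF: "N t \<in> borel_measurable (F t)" for t
  proof (cases "enat t \<le> T")
    case True
    note [measurable] = DF[OF order_refl True]
    have "(\<lambda>\<omega>. \<integral>\<^sup>+x. ennreal (D t x \<omega>) \<partial>lborel) \<in> borel_measurable (F t)"
      by (rule lborel.borel_measurable_nn_integral) (simp add: case_prod_beta')
    then show ?thesis
      using True by (simp add: N_def[abs_def])
  qed (simp add: N_def[abs_def])

  \<comment> \<open>The supermartingale inequality, for fixed \<open>x\<close> and for the
    mixture\<close>
  have Dstep: "(\<integral>\<^sup>+\<omega>. ennreal (D (Suc t) x \<omega>) * indicator A \<omega> \<partial>M)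
      \<le> (\<integral>\<^sup>+\<omega>. ennreal (D t x \<omega>) * indicator A \<omega> \<partial>M)"
    if "enat t < T" and A: "A \<in> sets (F t)" for t x A
  proof -
    interpret S: finite_measure_subalgebra M "F t"
      by unfold_locales (rule sub)
    \<comment> \<open>In this direction \<open>\<nu> \<omega> \<bullet> w t \<omega>\<close> is the
      noise term of the new increment, and the moment exponent \<open>q (\<nu> \<omega>)\<close>,
      after \<open>matrix_inv W\<close> cancels against \<open>W\<close>, is precisely the quadratic
      term subtracted from it.\<close>
    define \<nu> where "\<nu> \<omega> = (1 / cw\<^sup>2) *\<^sub>R (W *v (Mx t \<omega> *v x))" for \<omega>
    define q where "q v = 1 / 2 * cw\<^sup>2 * (v \<bullet> (matrix_inv W *v v))" for v
    have [measurable]: "A \<in> sets (F t)" by (rule A)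
    have [measurable]: "Mx t \<in> borel_measurable (F t)"
      using MF[OF order_refl \<open>enat t < T\<close>] .
    have "(\<lambda>\<omega>. (\<lambda>p. D t (snd p) (fst p)) (\<omega>, x)) \<in> borel_measurable (F t)"
      by (rule measurable_compose[OF _ DF]) (use \<open>enat t < T\<close> in auto)
    then have [measurable]: "D t x \<in> borel_measurable (F t)"
      by simp
    have step: "D (Suc t) x \<omega> = D t x \<omega> * exp (\<nu> \<omega> \<bullet> w t \<omega> - q (\<nu> \<omega>))" for \<omega>
    proof -
      let ?m = "Mx t \<omega> *v x"
      have "matrix_inv W *v (W *v ?m) = ?m"
        using dW by (metis matrix_inv_left matrix_vector_mul_assoc matrix_vector_mul_lid)
      then have "q (\<nu> \<omega>) = (?m \<bullet> (W *v ?m) / 2) / cw\<^sup>2"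
        using \<open>cw > 0\<close> by (simp add: q_def \<nu>_def matrix_vector_mult_scaleR inner_commute power2_eq_square)
      moreover have "\<nu> \<omega> \<bullet> w t \<omega> = (?m \<bullet> (W *v w t \<omega>)) / cw\<^sup>2"
        by (simp add: \<nu>_def symW)
      ultimately have "\<nu> \<omega> \<bullet> w t \<omega> - q (\<nu> \<omega>) = (?m \<bullet> (W *v w t \<omega>) - ?m \<bullet> (W *v ?m) / 2) / cw\<^sup>2"
        by (simp add: diff_divide_distrib)
      then show ?thesis
        by (simp add: D_def exp_add[symmetric] add_divide_distrib[symmetric] add.assoc)
    qed
    have "(\<lambda>\<omega>. D t x \<omega> * indicator A \<omega>) \<in> borel_measurable (F t)"
      by measurable
    moreover have "0 \<le> D t x \<omega> * indicator A \<omega>" for \<omega>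
      by (simp add: D_def)
    moreover have "continuous_on UNIV q"
      unfolding q_def by (intro continuous_intros linear_continuous_on_compose) auto
    moreover have "\<nu> \<in> borel_measurable (F t)"
      unfolding \<nu>_def by measurable
    moreover have "AE \<omega> in M. nn_cond_exp M (F t) (\<lambda>\<omega>. ennreal (exp (v \<bullet> w t \<omega>))) \<omega> \<le> ennreal (exp (q v))" for v
      using assms(7)[OF \<open>enat t < T\<close>, of v] \<open>enat t < T\<close> by (simp add: F_def q_def)
    ultimately have "(\<integral>\<^sup>+\<omega>. ennreal (D t x \<omega> * indicator A \<omega> * exp (\<nu> \<omega> \<bullet> w t \<omega> - q (\<nu> \<omega>))) \<partial>M)
        \<le> (\<integral>\<^sup>+\<omega>. ennreal (D t x \<omega> * indicator A \<omega>) \<partial>M)"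
      by (intro S.nn_integral_exp_inner_le assms(3)[OF \<open>enat t < T\<close>])
    moreover have "ennreal (D t x \<omega> * indicator A \<omega> * exp (\<nu> \<omega> \<bullet> w t \<omega> - q (\<nu> \<omega>)))
        = ennreal (D (Suc t) x \<omega>) * indicator A \<omega>" for \<omega>
      by (simp add: step indicator_def)
    moreover have "ennreal (D t x \<omega> * indicator A \<omega>) = ennreal (D t x \<omega>) * indicator A \<omega>" for \<omega>
      by (simp add: indicator_def)
    ultimately show ?thesis
      by simp
  qed

  interpret pair_sigma_finite M "lborel :: (real^'n) measure" ..
  have Fub: "(\<integral>\<^sup>+\<omega>\<in>A. N t \<omega> \<partial>M) = (\<integral>\<^sup>+x. (\<integral>\<^sup>+\<omega>. ennreal (D t x \<omega>) * indicator A \<omega> \<partial>M) \<partial>lborel)"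
    if "enat t \<le> T" and [measurable]: "A \<in> sets M" for t A
  proof -
    have "sets (F t \<Otimes>\<^sub>M (lborel :: (real^'n) measure)) \<subseteq> sets (M \<Otimes>\<^sub>M (lborel :: (real^'n) measure))"
      using sub[of t] by (intro sets_pair_in_sets) (auto simp: subalgebra_def intro!: pair_measureI)
    then have [measurable]: "(\<lambda>p. D t (snd p) (fst p)) \<in> borel_measurable (M \<Otimes>\<^sub>M lborel)"
      using DF[OF order_refl \<open>enat t \<le> T\<close>] sub[of t]
      by (auto simp: measurable_def space_pair_measure subalgebra_def)
    have "(\<integral>\<^sup>+\<omega>\<in>A. N t \<omega> \<partial>M) = (\<integral>\<^sup>+\<omega>. (\<integral>\<^sup>+x. ennreal (D t x \<omega>) * indicator A \<omega> \<partial>lborel) \<partial>M)"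
    proof (rule nn_integral_cong)
      fix \<omega>
      assume "\<omega> \<in> space M"
      show "N t \<omega> * indicator A \<omega> = (\<integral>\<^sup>+x. ennreal (D t x \<omega>) * indicator A \<omega> \<partial>lborel)"
        using \<open>enat t \<le> T\<close> by (simp add: N_def indicator_def)
    qed
    also have "\<dots> = (\<integral>\<^sup>+x. (\<integral>\<^sup>+\<omega>. ennreal (D t x \<omega>) * indicator A \<omega> \<partial>M) \<partial>lborel)"
      by (rule Fubini'[symmetric]) (simp add: case_prod_beta')
    finally show ?thesis .
  qed
  \<comment> \<open>Up to \<open>T\<close>, \<open>Fub\<close> puts the integral over
    \<open>x\<close> outside and \<open>Dstep\<close> compares the integrands for each
    \<open>x\<close>; beyond \<open>T\<close> the left side is 0.\<close>
  have super: "(\<integral>\<^sup>+\<omega>\<in>A. N (Suc t) \<omega> \<partial>M) \<le> (\<integral>\<^sup>+\<omega>\<in>A. N t \<omega> \<partial>M)"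
    if A: "A \<in> sets (F t)" for t A
  proof (cases "enat (Suc t) \<le> T")
    case True
    then have t: "enat t < T"
      by (metis enat_ord_simps(2) lessI less_le_trans)
    have "A \<in> sets M"
      using A sub[of t] by (auto simp: subalgebra_def)
    then show ?thesis
      using True t A by (simp add: Fub less_imp_le nn_integral_mono Dstep)
  qed (simp add: N_def)

  \<comment> \<open>Closed form of the mixture and the final bound\<close>
  define K where "K = sqrt (2 * pi * cw\<^sup>2) ^ CARD('n)"
  have "0 < K"
    using \<open>cw > 0\<close> by (simp add: K_def)
  have Neq: "N t \<omega> = ennreal (K / sqrt (det (Pbar + Vmat W Mx t \<omega>))
      * exp (wnorm2 (matrix_inv (Pbar + Vmat W Mx t \<omega>)) (z + svec W Mx w t \<omega>) / (2 * cw\<^sup>2)))"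
    if "enat t \<le> T" for t \<omega>
  proof -
    have "D t x \<omega> = exp ((x \<bullet> (z + svec W Mx w t \<omega>) - x \<bullet> ((Pbar + Vmat W Mx t \<omega>) *v x) / 2) / cw\<^sup>2)" for x
      by (simp add: D_def inner_add_right matrix_vector_mult_add_rdistrib inner_svec
          Vmat_quadratic_form sum_subtractf sum_divide_distrib add_divide_distrib diff_divide_distrib)
    then show ?thesis
      using that nn_integral_gaussian[OF pos_def_mat_add_Vmat[OF assms(8,5)] \<open>cw > 0\<close>]
      by (simp add: N_def K_def wnorm2_def)
  qed
  define Z where "Z = K / sqrt (det Pbar) * exp (wnorm2 (matrix_inv Pbar) z / (2 * cw\<^sup>2))"
  have "0 < Z"
    using \<open>0 < K\<close> dP by (simp add: Z_def)
  have "enat 0 \<le> T"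
    by (simp add: zero_enat_def[symmetric])
  then have N0: "N 0 \<omega> = ennreal Z" for \<omega>
    by (simp add: Neq Z_def Vmat_def svec_def)
  \<comment> \<open>The strict inequality makes the complement consist of non-strict ones, as in the
    claim.\<close>
  define B where "B = {\<omega> \<in> space M. \<exists>t. ennreal (Z / \<delta>) < N t \<omega>}"
  have "N t \<in> borel_measurable M" for t
    by (rule measurable_from_subalg[OF sub NF])
  then have B[measurable]: "B \<in> events"
    unfolding B_def by measurable
  have "ennreal (Z / \<delta>) * emeasure M B \<le> (\<integral>\<^sup>+\<omega>. N 0 \<omega> \<partial>M)"
    unfolding B_def by (rule ville_maximal_inequality[where F = F and N = N, OF sub mono NF super])
  also have "\<dots> = ennreal Z"
    by (simp add: N0 emeasure_space_1)
  finally have "ennreal (Z / \<delta> * prob B) \<le> ennreal Z"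
    using \<open>0 < Z\<close> \<open>0 < \<delta>\<close> by (subst ennreal_mult) (simp_all add: emeasure_eq_measure)
  then have "Z / \<delta> * prob B \<le> Z"
    using \<open>0 < Z\<close> by (subst (asm) ennreal_le_iff) simp_all
  then have "prob B \<le> \<delta>"
    using \<open>0 < Z\<close> \<open>0 < \<delta>\<close> by (simp add: field_simps)
  then have "1 - \<delta> \<le> prob (space M - B)"
    by (simp add: prob_compl)
  also have "space M - B = {\<omega> \<in> space M. \<forall>t. enat t \<le> T \<longrightarrow>
            wnorm2 (matrix_inv (Pbar + Vmat W Mx t \<omega>)) (z + svec W Mx w t \<omega>)
              \<le> wnorm2 (matrix_inv Pbar) z
                 + cw^2 * (ln (det (mat 1 + matrix_inv Pbar ** Vmat W Mx t \<omega>)) + 2 * ln (1/\<delta>))}"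
  proof -
    \<comment> \<open>After \<open>T\<close> both sides hold trivially, because \<open>N\<close> is
      0 there; up to \<open>T\<close> this is the logarithmic form of the threshold.\<close>
    have "N t \<omega> \<le> ennreal (Z / \<delta>) \<longleftrightarrow> (enat t \<le> T \<longrightarrow>
            wnorm2 (matrix_inv (Pbar + Vmat W Mx t \<omega>)) (z + svec W Mx w t \<omega>)
              \<le> wnorm2 (matrix_inv Pbar) z
                 + cw^2 * (ln (det (mat 1 + matrix_inv Pbar ** Vmat W Mx t \<omega>)) + 2 * ln (1/\<delta>)))"
      for t \<omega>
    proof (cases "enat t \<le> T")
      case True
      have dV: "0 < det (Pbar + Vmat W Mx t \<omega>)"
        by (rule pos_def_mat_det_pos[OF pos_def_mat_add_Vmat[OF assms(8,5)]])
      have "N t \<omega> \<le> ennreal (Z / \<delta>) \<longleftrightarrow>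
          K / sqrt (det (Pbar + Vmat W Mx t \<omega>))
            * exp (wnorm2 (matrix_inv (Pbar + Vmat W Mx t \<omega>)) (z + svec W Mx w t \<omega>) / (2 * cw\<^sup>2))
          \<le> K / sqrt (det Pbar) * exp (wnorm2 (matrix_inv Pbar) z / (2 * cw\<^sup>2)) / \<delta>"
        unfolding Neq[OF True] Z_def[symmetric] using \<open>0 < Z\<close> \<open>0 < \<delta>\<close> by (intro ennreal_le_iff) simp
      also have "\<dots> \<longleftrightarrow> wnorm2 (matrix_inv (Pbar + Vmat W Mx t \<omega>)) (z + svec W Mx w t \<omega>)
          \<le> wnorm2 (matrix_inv Pbar) z
            + cw\<^sup>2 * (ln (det (Pbar + Vmat W Mx t \<omega>) / det Pbar) + 2 * ln (1/\<delta>))"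
        by (rule gaussian_ratio_le_iff[OF \<open>0 < K\<close> dP dV \<open>cw > 0\<close> \<open>0 < \<delta>\<close>])
      finally show ?thesis
        using True dP by (simp add: det_one_add_inv_mult)
    qed (simp add: N_def)
    moreover have "space M - B = {\<omega> \<in> space M. \<forall>t. N t \<omega> \<le> ennreal (Z / \<delta>)}"
      by (auto simp: B_def not_less[symmetric])
    ultimately show ?thesis
      by simp
  qed
  finally show ?thesis .
qed

end
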